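(* Let $X_1,X_2,\dots$ be any sequence of (possibly correlated) random variables with $\mathrm{Var}(X_i)<+\infty$ for $i=1,2,\dots$. Suppose that at least one of the following two conditions holds: (1) $\frac1n\sum_{i=1}^n\mathrm{Var}(X_i)\to0$ as $n\to+\infty$; (2) there exist $C>0$ and $0<s<1$ such that both (a) and (b) hold: (a) either $\big|\frac1n\sum_{i=1}^n\mathrm{Var}(X_i)\big|<C$ for all $n$, or $\big|\frac1n\sum_{i=1}^n\mathrm{Var}(X_i)\big|=O(n^s)$; (b) either $\big|\frac1n\sum_{1\le i<j\le n}\mathrm{Cov}(X_i,X_j)\big|<C$ for all $n$, or $\big|\frac1n\sum_{1\le i<j\le n}\mathrm{Cov}(X_i,X_j)\big|=O(n^s)$. Then for any $\varepsilon>0$, $$\lim_{n\to\infty}P\Big(\Big|\frac1n\sum_{i=1}^nX_i-\frac1n\sum_{i=1}^nE X_i\Big|<\varepsilon\Big)=1.$$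
   Context: Random variables are real-valued, defined on a common probability space with probability $P$, with finite expectation and variance. "Correlated" only means that no independence or uncorrelatedness is assumed. $E$, $\mathrm{Var}$, $\mathrm{Cov}$ denote expectation, variance and covariance. Here, for a nonnegative sequence $a_n$, the notation $a_n=O(n^s)$ means that $a_n$ is infinite of the same order as $n^s$ as $n\to\infty$, i.e. there are constants $0<c_1\le c_2$ with $c_1n^s\le a_n\le c_2n^s$ for all sufficiently large $n$. *)

theory Defs
  imports "HOL-Probability.Probability"
begin

definition covariance :: "'a measure \<Rightarrow> ('a \<Rightarrow> real) \<Rightarrow> ('a \<Rightarrow> real) \<Rightarrow> real" where
  "covariance M X Y =
     prob_space.expectation M
       (\<lambda>\<omega>. (X \<omega> - prob_space.expectation M X) * (Y \<omega> - prob_space.expectation M Y))"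

(* The Bochner integral of a non-integrable function is 0, so finiteness of the expectation
   and of the variance is expressed as integrability, never as a bound on their values. *)
definition finite_mean_variance :: "'a measure \<Rightarrow> ('a \<Rightarrow> real) \<Rightarrow> bool" where
  "finite_mean_variance M X \<longleftrightarrow>
     integrable M X \<and> integrable M (\<lambda>\<omega>. (X \<omega> - prob_space.expectation M X)\<^sup>2)"

definition avg_variance :: "'a measure \<Rightarrow> (nat \<Rightarrow> 'a \<Rightarrow> real) \<Rightarrow> nat \<Rightarrow> real" where
  "avg_variance M X n = 1 / real n * (\<Sum>i=1..n. prob_space.variance M (X i))"

definition avg_covariance :: "'a measure \<Rightarrow> (nat \<Rightarrow> 'a \<Rightarrow> real) \<Rightarrow> nat \<Rightarrow> real" where
  "avg_covariance M X n =
     1 / real n * (\<Sum>(i, j) \<in> {(i, j). 1 \<le> i \<and> i < j \<and> j \<le> n}. covariance M (X i) (X j))"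

(* "Of the same order as" is two-sided here, hence bigtheta rather than bigo. *)
definition bounded_or_order :: "(nat \<Rightarrow> real) \<Rightarrow> real \<Rightarrow> real \<Rightarrow> bool" where
  "bounded_or_order a C s \<longleftrightarrow>
     (\<forall>n\<ge>1. \<bar>a n\<bar> < C) \<or> (\<lambda>n. \<bar>a n\<bar>) \<in> \<Theta>(\<lambda>n. real n powr s)"

end

theory Submission
  imports Defs
begin

text \<open>
  Both conditions make the second moment of the centred average tend to zero, and Chebyshev's
  inequality does the rest. Writing \<open>Y i\<close> for the centred variables, condition (1) is handled by
  the Cauchy--Schwarz bound \<open>(\<Sum>i\<le>n. Y i)\<^sup>2 \<le> n (\<Sum>i\<le>n. (Y i)\<^sup>2)\<close>, and condition (2) by expanding the
  square: the second moment is the average variance plus twice the average covariance, divided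
  by \<open>n\<close>, and both averages are at most of order \<open>n powr s\<close> with \<open>s < 1\<close>.
\<close>

text \<open>The pairs gained in passing from \<open>n\<close> to \<open>Suc n\<close> are
  \<open>(i, Suc n)\<close> with \<open>i\<close> in \<open>{1..n}\<close>; their products add up to
  half the cross term of the enlarged square. The index set is that of
  \<open>avg_covariance\<close>, so expectations can be taken term by term.\<close>

lemma square_sum_eq_pairs:
  fixes y :: "nat \<Rightarrow> real"
  shows "(\<Sum>i=1..n. y i)\<^sup>2 =
    (\<Sum>i=1..n. (y i)\<^sup>2) + 2 * (\<Sum>(i, j) \<in> {(i, j). 1 \<le> i \<and> i < j \<and> j \<le> n}. y i * y j)"
proof (induction n)
  case 0
  show ?case by (auto intro!: sum.neutral)
next
  case (Suc n)
  let ?P = "\<lambda>n::nat. {(i, j). 1 \<le> i \<and> i < j \<and> j \<le> n}"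
  have fin: "finite (?P n)"
    by (rule finite_subset[of _ "{..n} \<times> {..n}"]) auto
  have "?P (Suc n) = ?P n \<union> (\<lambda>i. (i, Suc n)) ` {1..n}" by auto
  moreover have "?P n \<inter> (\<lambda>i. (i, Suc n)) ` {1..n} = {}" by auto
  ultimately have "(\<Sum>(i, j) \<in> ?P (Suc n). y i * y j) =
      (\<Sum>(i, j) \<in> ?P n. y i * y j) + (\<Sum>(i, j) \<in> (\<lambda>i. (i, Suc n)) ` {1..n}. y i * y j)"
    using fin by (simp add: sum.union_disjoint)
  also have "(\<Sum>(i, j) \<in> (\<lambda>i. (i, Suc n)) ` {1..n}. y i * y j) = (\<Sum>i=1..n. y i) * y (Suc n)"
    by (subst sum.reindex) (auto simp: inj_on_def sum_distrib_right)
  finally show ?case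
    using Suc.IH by (simp add: power2_sum algebra_simps)
qed

text \<open>Both alternatives give \<open>a\<close> in \<open>O(n powr s)\<close>: a constant bound
  is absorbed because \<open>s > 0\<close>. Then \<open>s < 1\<close> makes \<open>n powr s\<close>
  negligible against \<open>n\<close>.\<close>

lemma bounded_or_order_over_n:
  assumes "bounded_or_order a C s" "0 < s" "s < 1"
  shows "(\<lambda>n. a n / real n) \<longlonglongrightarrow> 0"
proof -
  have "a \<in> O(\<lambda>n. real n powr s)"
    using assms(1) unfolding bounded_or_order_def
  proof
    assume C: "\<forall>n\<ge>1. \<bar>a n\<bar> < C"
    have "a \<in> O(\<lambda>_. 1)"
      by (rule bigoI[of _ C]) (use C in \<open>auto simp: eventually_at_top_linorder intro!: exI[of _ 1] less_imp_le\<close>)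
    also have "(\<lambda>_. 1) \<in> O(\<lambda>n::nat. real n powr s)"
      using \<open>0 < s\<close> by real_asymp
    finally show ?thesis .
  qed auto
  also have "(\<lambda>n::nat. real n powr s) \<in> o(\<lambda>n. real n)"
    using assms(2,3) by real_asymp
  finally show ?thesis by (rule smalloD_tendsto)
qed

text \<open>Chebyshev's inequality bounds the complementary event, which squeezes the probability
  between 1 minus a null sequence and 1.\<close>

lemma (in prob_space) prob_abs_less_tendsto_1:
  fixes D :: "nat \<Rightarrow> 'a \<Rightarrow> real"
  assumes "\<And>n. D n \<in> borel_measurable M"
    and "\<And>n. integrable M (\<lambda>\<omega>. (D n \<omega>)\<^sup>2)"
    and lim: "(\<lambda>n. expectation (\<lambda>\<omega>. (D n \<omega>)\<^sup>2)) \<longlonglongrightarrow> 0"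
    and "\<epsilon> > 0"
  shows "(\<lambda>n. prob {\<omega> \<in> space M. \<bar>D n \<omega>\<bar> < \<epsilon>}) \<longlonglongrightarrow> 1"
proof (rule tendsto_sandwich)
  note [measurable] = assms(1)
  have "1 - expectation (\<lambda>\<omega>. (D n \<omega>)\<^sup>2) / \<epsilon>\<^sup>2 \<le> prob {\<omega> \<in> space M. \<bar>D n \<omega>\<bar> < \<epsilon>}" for n
  proof -
    have "prob {\<omega> \<in> space M. \<epsilon> \<le> \<bar>D n \<omega>\<bar>} \<le> expectation (\<lambda>\<omega>. (D n \<omega>)\<^sup>2) / \<epsilon>\<^sup>2"
      by (rule second_moment_method) (use assms in auto)
    moreover have "prob {\<omega> \<in> space M. \<bar>D n \<omega>\<bar> < \<epsilon>} = 1 - prob {\<omega> \<in> space M. \<epsilon> \<le> \<bar>D n \<omega>\<bar>}"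
      by (subst prob_neg[symmetric]) (auto simp: not_le)
    ultimately show ?thesis by simp
  qed
  then show "\<forall>\<^sub>F n in sequentially. 1 - expectation (\<lambda>\<omega>. (D n \<omega>)\<^sup>2) / \<epsilon>\<^sup>2
      \<le> prob {\<omega> \<in> space M. \<bar>D n \<omega>\<bar> < \<epsilon>}" by simp
  show "(\<lambda>n. 1 - expectation (\<lambda>\<omega>. (D n \<omega>)\<^sup>2) / \<epsilon>\<^sup>2) \<longlonglongrightarrow> 1"
    using tendsto_diff[OF tendsto_const[of 1] tendsto_divide[OF lim tendsto_const[of "\<epsilon>\<^sup>2"]]] \<open>\<epsilon> > 0\<close>
    by simp
qed auto

theorem theorem12:
  fixes M :: "'a measure" and X :: "nat \<Rightarrow> 'a \<Rightarrow> real" and \<epsilon> :: real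
  assumes "prob_space M"
    and "\<And>i. i \<ge> 1 \<Longrightarrow> X i \<in> borel_measurable M"
    and "\<And>i. i \<ge> 1 \<Longrightarrow> finite_mean_variance M (X i)"
    and "avg_variance M X \<longlonglongrightarrow> 0 \<or>
         (\<exists>C s. C > 0 \<and> 0 < s \<and> s < 1 \<and>
            bounded_or_order (avg_variance M X) C s \<and>
            bounded_or_order (avg_covariance M X) C s)"
    and "\<epsilon> > 0"
  shows "(\<lambda>n. measure M {\<omega> \<in> space M.
            \<bar>1 / real n * (\<Sum>i=1..n. X i \<omega>)
             - 1 / real n * (\<Sum>i=1..n. prob_space.expectation M (X i))\<bar> < \<epsilon>})
         \<longlonglongrightarrow> 1"
proof -
  interpret prob_space M by fact
  define Y where "Y i \<omega> = X i \<omega> - expectation (X i)" for i \<omega>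
  \<comment> \<open>Division by zero yields 0, so \<open>D 0\<close> vanishes and the formulas below
    hold for \<open>n = 0\<close> too.\<close>
  define D where "D n \<omega> = (\<Sum>i=1..n. Y i \<omega>) / real n" for n \<omega>
  let ?W = "\<lambda>n. expectation (\<lambda>\<omega>. (D n \<omega>)\<^sup>2)"
  let ?P = "\<lambda>n::nat. {(i, j). 1 \<le> i \<and> i < j \<and> j \<le> n}"
  have meas: "Y i \<in> borel_measurable M" if "i \<ge> 1" for i
    using assms(2)[OF that] unfolding Y_def by measurable
  have int: "integrable M (\<lambda>\<omega>. (Y i \<omega>)\<^sup>2)" if "i \<ge> 1" for i
    using assms(3)[OF that] by (simp add: finite_mean_variance_def Y_def)
  \<comment> \<open>Finite variances make the covariances genuine integrals, so the integral of the
    expanded square may be split.\<close>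
  have int_mult: "integrable M (\<lambda>\<omega>. Y i \<omega> * Y j \<omega>)" if "i \<ge> 1" "j \<ge> 1" for i j
  proof (rule Bochner_Integration.integrable_bound)
    show "integrable M (\<lambda>\<omega>. (Y i \<omega>)\<^sup>2 + (Y j \<omega>)\<^sup>2)"
      using that by (intro Bochner_Integration.integrable_add int)
    \<comment> \<open>From \<open>2 * \<bar>a\<bar> * \<bar>b\<bar> \<le> a\<^sup>2 +
      b\<^sup>2\<close>, where the factor 2 is dropped by nonnegativity.\<close>
    have "\<bar>a * b\<bar> \<le> a\<^sup>2 + b\<^sup>2" for a b :: real
      using sum_squares_bound[of "\<bar>a\<bar>" "\<bar>b\<bar>"] mult_nonneg_nonneg[of "\<bar>a\<bar>" "\<bar>b\<bar>"]
      unfolding abs_mult power2_abs by linarith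
    then show "AE \<omega> in M. norm (Y i \<omega> * Y j \<omega>) \<le> norm ((Y i \<omega>)\<^sup>2 + (Y j \<omega>)\<^sup>2)" by simp
  qed (use that meas in auto)
  have int_squares: "integrable M (\<lambda>\<omega>. \<Sum>i=1..n. (Y i \<omega>)\<^sup>2)" for n
    by (rule Bochner_Integration.integrable_sum) (auto intro: int)
  have int_pairs: "integrable M (\<lambda>\<omega>. \<Sum>(i, j) \<in> ?P n. Y i \<omega> * Y j \<omega>)" for n
    by (rule Bochner_Integration.integrable_sum) (auto intro: int_mult)
  have D_sq: "(D n \<omega>)\<^sup>2 =
      ((\<Sum>i=1..n. (Y i \<omega>)\<^sup>2) + 2 * (\<Sum>(i, j) \<in> ?P n. Y i \<omega> * Y j \<omega>)) / (real n)\<^sup>2" for n \<omega>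
    unfolding D_def power_divide square_sum_eq_pairs ..
  have int_D: "integrable M (\<lambda>\<omega>. (D n \<omega>)\<^sup>2)" for n
    unfolding D_sq using int_squares int_pairs by simp
  have avg_var: "(\<integral>\<omega>. (\<Sum>i=1..n. (Y i \<omega>)\<^sup>2) \<partial>M) / real n = avg_variance M X n" for n
    unfolding avg_variance_def
    by (subst Bochner_Integration.integral_sum) (auto simp: int simp flip: Y_def)
  have avg_cov: "(\<integral>\<omega>. (\<Sum>(i, j) \<in> ?P n. Y i \<omega> * Y j \<omega>) \<partial>M) / real n = avg_covariance M X n" for n
    unfolding avg_covariance_def covariance_def
    by (subst Bochner_Integration.integral_sum)
       (auto simp: int_mult case_prod_beta simp flip: Y_def)
  have "?W \<longlonglongrightarrow> 0"
    using assms(4)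
  proof
    assume lim: "avg_variance M X \<longlonglongrightarrow> 0"
    show ?thesis
    proof (rule tendsto_sandwich[OF _ _ tendsto_const lim])
      have "?W n \<le> avg_variance M X n" for n
      proof -
        \<comment> \<open>The Cauchy--Schwarz factor \<open>n\<close> cancels one of the two factors
          \<open>n\<close> in the denominator, and no cross terms appear.\<close>
        have "(D n \<omega>)\<^sup>2 \<le> (\<Sum>i=1..n. (Y i \<omega>)\<^sup>2) / real n" for \<omega>
          using sum_squared_le_sum_of_squares[of "\<lambda>i. Y i \<omega>" "{1..n}"]
          by (cases "n = 0") (auto simp: D_def field_simps power2_eq_square)
        then have "?W n \<le> (\<integral>\<omega>. (\<Sum>i=1..n. (Y i \<omega>)\<^sup>2) / real n \<partial>M)"
          using int_D int_squares by (intro integral_mono) auto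
        then show ?thesis by (simp add: avg_var[symmetric])
      qed
      then show "\<forall>\<^sub>F n in sequentially. ?W n \<le> avg_variance M X n" by simp
    qed simp
  next
    assume "\<exists>C s. C > 0 \<and> 0 < s \<and> s < 1 \<and>
      bounded_or_order (avg_variance M X) C s \<and> bounded_or_order (avg_covariance M X) C s"
    then have lim: "(\<lambda>n. avg_variance M X n / real n) \<longlonglongrightarrow> 0"
        "(\<lambda>n. avg_covariance M X n / real n) \<longlonglongrightarrow> 0"
      by (auto intro: bounded_or_order_over_n)
    \<comment> \<open>One factor of \<open>(real n)\<^sup>2\<close> is absorbed by the averages; the
      other supplies the division that beats growth of order \<open>n powr s\<close>.\<close>
    have "?W n = avg_variance M X n / real n + 2 * (avg_covariance M X n / real n)" for n
      unfolding D_sq avg_var[symmetric] avg_cov[symmetric]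
      using int_squares int_pairs by (simp add: power2_eq_square add_divide_distrib)
    then show ?thesis
      using tendsto_add[OF lim(1) tendsto_mult[OF tendsto_const[of 2] lim(2)]] by simp
  qed
  moreover have "D n \<in> borel_measurable M" for n
    unfolding D_def using meas by (intro borel_measurable_divide borel_measurable_sum) auto
  ultimately have "(\<lambda>n. prob {\<omega> \<in> space M. \<bar>D n \<omega>\<bar> < \<epsilon>}) \<longlonglongrightarrow> 1"
    using int_D \<open>\<epsilon> > 0\<close> by (intro prob_abs_less_tendsto_1) auto
  moreover have "D n \<omega> = 1 / real n * (\<Sum>i=1..n. X i \<omega>) - 1 / real n * (\<Sum>i=1..n. expectation (X i))"
    for n \<omega>
    by (simp add: D_def Y_def sum_subtractf diff_divide_distrib)
  ultimately show ?thesis by simp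
qed

end
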